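(* Let $k\ge 3$, $g\ge 2$ and $s\ge 1$ be integers. Then: (1) $\rho(Lop_{g+1,k,s;1})<\rho(Lop_{g,k,s;1})$; (2) $\rho(Lop_{g+1,k,s;2})<\rho(Lop_{g,k,s;2})$.
   Context: A hypergraph $\mathcal{G}=(V,E)$ consists of a finite nonempty vertex set $V$ and a set $E$ of edges, each edge being a subset of $V$ with at least two elements (edges are pairwise distinct, undirected). It is $k$-uniform if every edge has exactly $k$ elements. Adjacency matrix: $\mathcal{A}_{\mathcal{G}}$ is the real symmetric matrix indexed by $V$ with $(\mathcal{A}_{\mathcal{G}})_{ij}=\sum_{e\in E,\ i,j\in e}\frac{1}{|e|-1}$ for $i\ne j$, and zero diagonal. The spectral radius $\rho(\mathcal{G})$ is the maximum modulus of the eigenvalues of $\mathcal{A}_{\mathcal{G}}$. A hyperpath of length $q$ is an alternating sequence $v_1e_1v_2e_2\cdots v_qe_qv_{q+1}$ of distinct vertices and distinct edges with $v_i,v_{i+1}\in e_i$, $e_i\cap e_{i+1}=\{v_{i+1}\}$, and $e_i\cap e_j=\emptyset$ if $|i-j|\ge 2$. For $g\ge 2$, $\mathcal{C}_g$ denotes the $k$-uniform $g$-hypercycle $v_1e_1v_2e_2\cdots v_ge_gv_1$ with $e_i=\{v_i,v_{a(i,1)},\dots,v_{a(i,k-2)},v_{i+1}\}$ for $1\le i\le g$ (where $v_{g+1}:=v_1$), all the vertices $v_i$ and $v_{a(i,j)}$ ($1\le i\le g$, $1\le j\le k-2$) being distinct; for $g=2$ the two edges share exactly the two vertices $v_1,v_2$.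 $Lop_{g,k,s;1}$ (resp. $Lop_{g,k,s;2}$) is the $k$-uniform lollipop hypergraph obtained by attaching a pendant $k$-uniform hyperpath of length $s$ at vertex $v_1$ (resp. $v_{a(1,1)}$) of $\mathcal{C}_g$, i.e. identifying the initial vertex of the hyperpath with that vertex, the two being otherwise disjoint. *)

theory Defs
  imports "Jordan_Normal_Form.Spectral_Radius" "HOL-Library.Countable_Set"
begin

record 'a hypergraph =
  verts :: "'a set"
  edges :: "'a set set"

definition is_hypergraph :: "'a hypergraph \<Rightarrow> bool" where
  "is_hypergraph G \<longleftrightarrow> finite (verts G) \<and> verts G \<noteq> {} \<and>
     (\<forall>e\<in>edges G. e \<subseteq> verts G \<and> 2 \<le> card e)"

definition uniform :: "nat \<Rightarrow> 'a hypergraph \<Rightarrow> bool" where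
  "uniform k G \<longleftrightarrow> (\<forall>e\<in>edges G. card e = k)"

definition adjacency :: "'a hypergraph \<Rightarrow> 'a \<Rightarrow> 'a \<Rightarrow> real" where
  "adjacency G i j =
     (if i = j then 0 else \<Sum>e | e \<in> edges G \<and> i \<in> e \<and> j \<in> e. 1 / (real (card e) - 1))"

text \<open>
  Matrices of type \<open>mat\<close> are indexed by natural numbers, so the vertices are enumerated by
  \<open>from_nat_into\<close>, a bijection from \<open>{..<card (verts G)}\<close> onto \<open>verts G\<close> when \<open>verts G\<close> is
  finite. Another enumeration would give a permutation-similar matrix.
\<close>

definition adjacency_matrix :: "'a hypergraph \<Rightarrow> real mat" where
  "adjacency_matrix G = mat (card (verts G)) (card (verts G))
     (\<lambda>(i, j). adjacency G (from_nat_into (verts G) i) (from_nat_into (verts G) j))"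

definition hg_spectral_radius :: "'a hypergraph \<Rightarrow> real" where
  "hg_spectral_radius G = spectral_radius (map_mat complex_of_real (adjacency_matrix G))"

text \<open>
  \<open>hyperpath q v e\<close>: the sequence \<open>v 1, e 1, v 2, e 2, \<dots>, v q, e q, v (q + 1)\<close> is a hyperpath of
  length \<open>q\<close>.
\<close>

definition hyperpath :: "nat \<Rightarrow> (nat \<Rightarrow> 'a) \<Rightarrow> (nat \<Rightarrow> 'a set) \<Rightarrow> bool" where
  "hyperpath q v e \<longleftrightarrow> inj_on v {1..q + 1} \<and> inj_on e {1..q} \<and>
     (\<forall>i\<in>{1..q}. v i \<in> e i \<and> v (i + 1) \<in> e i) \<and>
     (\<forall>i\<in>{1..<q}. e i \<inter> e (i + 1) = {v (i + 1)}) \<and>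
     (\<forall>i\<in>{1..q}. \<forall>j\<in>{1..q}. i + 2 \<le> j \<longrightarrow> e i \<inter> e j = {})"

text \<open>
  Vertex labels: \<open>Cyc i\<close> and \<open>CycIn i j\<close> are the vertices $v_i$ and $v_{a(i,j)}$ of the hypercycle;
  \<open>Pth i\<close> and \<open>PthIn i j\<close> are the vertices of the pendant hyperpath other than its initial one.
  Hypercycles and lollipops are only determined up to isomorphism, and these labels fix a
  representative.
\<close>

datatype vertex = Cyc nat | CycIn nat nat | Pth nat | PthIn nat nat

definition cycle_edge :: "nat \<Rightarrow> nat \<Rightarrow> nat \<Rightarrow> vertex set" where
  "cycle_edge g k i =
     {Cyc i, Cyc (if i = g then 1 else i + 1)} \<union> CycIn i ` {1..k - 2}"

definition hypercycle :: "nat \<Rightarrow> nat \<Rightarrow> vertex hypergraph" where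
  "hypercycle g k =
     \<lparr>verts = Cyc ` {1..g} \<union> {CycIn i j | i j. i \<in> {1..g} \<and> j \<in> {1..k - 2}},
      edges = cycle_edge g k ` {1..g}\<rparr>"

text \<open>The hyperpath has initial vertex \<open>u\<close>, a vertex of the hypercycle; this is the identification.\<close>

definition path_vertex :: "vertex \<Rightarrow> nat \<Rightarrow> vertex" where
  "path_vertex u i = (if i = 1 then u else Pth i)"

definition path_edge :: "vertex \<Rightarrow> nat \<Rightarrow> nat \<Rightarrow> vertex set" where
  "path_edge u k i = {path_vertex u i, path_vertex u (i + 1)} \<union> PthIn i ` {1..k - 2}"

definition attach_path :: "vertex hypergraph \<Rightarrow> vertex \<Rightarrow> nat \<Rightarrow> nat \<Rightarrow> vertex hypergraph" where
  "attach_path G u k s =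
     \<lparr>verts = verts G \<union> (\<Union>i\<in>{1..s}. path_edge u k i),
      edges = edges G \<union> path_edge u k ` {1..s}\<rparr>"

definition Lop1 :: "nat \<Rightarrow> nat \<Rightarrow> nat \<Rightarrow> vertex hypergraph" where
  "Lop1 g k s = attach_path (hypercycle g k) (Cyc 1) k s"

definition Lop2 :: "nat \<Rightarrow> nat \<Rightarrow> nat \<Rightarrow> vertex hypergraph" where
  "Lop2 g k s = attach_path (hypercycle g k) (CycIn 1 1) k s"

lemma card_cycle_edge:
  assumes "3 \<le> k" "2 \<le> g"
  shows "card (cycle_edge g k i) = k"
proof -
  have "card (CycIn i ` {1..k - 2}) = k - 2"
    by (subst card_image) (auto simp: inj_on_def)
  moreover have "card {Cyc i, Cyc (if i = g then 1 else i + 1)} = 2"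
    using assms by auto
  moreover have "{Cyc i, Cyc (if i = g then 1 else i + 1)} \<inter> CycIn i ` {1..k - 2} = {}"
    by auto
  ultimately show ?thesis
    using assms unfolding cycle_edge_def by (subst card_Un_disjoint) auto
qed

lemma card_path_edge:
  assumes "3 \<le> k" "u \<in> verts (hypercycle g k)" "1 \<le> i"
  shows "card (path_edge u k i) = k"
proof -
  have "card (PthIn i ` {1..k - 2}) = k - 2"
    by (subst card_image) (auto simp: inj_on_def)
  moreover have "card {path_vertex u i, path_vertex u (i + 1)} = 2"
    using assms by (auto simp: path_vertex_def hypercycle_def)
  moreover have "{path_vertex u i, path_vertex u (i + 1)} \<inter> PthIn i ` {1..k - 2} = {}"
    using assms by (auto simp: path_vertex_def hypercycle_def)
  ultimately show ?thesis
    using assms unfolding path_edge_def by (subst card_Un_disjoint) auto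
qed

lemma hyperpath_path_edge:
  assumes "u \<in> verts (hypercycle g k)"
  shows "hyperpath s (path_vertex u) (path_edge u k)"
proof -
  have u: "u \<noteq> Pth i" "u \<noteq> PthIn i j" for i j
    using assms by (auto simp: hypercycle_def)
  have "inj_on (path_edge u k) {1..s}"
  proof (rule inj_onI)
    fix i j assume ij: "i \<in> {1..s}" "j \<in> {1..s}" "path_edge u k i = path_edge u k j"
    have *: "m + 1 = n \<or> m = n" if "1 \<le> m" "Pth (m + 1) \<in> path_edge u k n" for m n
      using that u by (auto simp: path_edge_def path_vertex_def split: if_splits)
    have "Pth (i + 1) \<in> path_edge u k i" "Pth (j + 1) \<in> path_edge u k j"
      using ij(1,2) by (simp_all add: path_edge_def path_vertex_def)
    hence "Pth (i + 1) \<in> path_edge u k j" "Pth (j + 1) \<in> path_edge u k i"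
      using ij(3) by simp_all
    with * [of i j] * [of j i] ij(1,2) show "i = j" by auto
  qed
  moreover have "inj_on (path_vertex u) {1..s + 1}"
    using u by (auto simp: inj_on_def path_vertex_def)
  moreover have "path_vertex u i \<in> path_edge u k i \<and> path_vertex u (i + 1) \<in> path_edge u k i" for i
    by (simp add: path_edge_def)
  moreover have "path_edge u k i \<inter> path_edge u k (i + 1) = {path_vertex u (i + 1)}" if "1 \<le> i" for i
    using that u u[symmetric] by (auto simp: path_edge_def path_vertex_def)
  moreover have "path_edge u k i \<inter> path_edge u k j = {}" if "1 \<le> i" "i + 2 \<le> j" for i j
    using that u u[symmetric] by (auto simp: path_edge_def path_vertex_def)
  ultimately show ?thesis
    by (simp add: hyperpath_def)
qed

lemma path_edge_Int_hypercycle: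
  assumes "u \<in> verts (hypercycle g k)" "1 \<le> s"
  shows "(\<Union>i\<in>{1..s}. path_edge u k i) \<inter> verts (hypercycle g k) = {u}"
  using assms by (auto simp: path_edge_def path_vertex_def hypercycle_def split: if_splits)

lemma attach_path_wellformed:
  assumes "3 \<le> k" "2 \<le> g" "u \<in> verts (hypercycle g k)"
  shows "is_hypergraph (attach_path (hypercycle g k) u k s)"
    and "uniform k (attach_path (hypercycle g k) u k s)"
proof -
  let ?G = "attach_path (hypercycle g k) u k s"
  show u: "uniform k ?G"
    using card_cycle_edge[OF assms(1,2)] card_path_edge[OF assms(1,3)]
    by (auto simp: uniform_def attach_path_def hypercycle_def)
  have "{CycIn i j | i j. i \<in> {1..g} \<and> j \<in> {1..k - 2}} =
      (\<lambda>(i, j). CycIn i j) ` ({1..g} \<times> {1..k - 2})" by auto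
  hence "finite (verts (hypercycle g k))"
    unfolding hypercycle_def by simp
  hence "finite (verts ?G)"
    by (auto simp: attach_path_def path_edge_def)
  moreover have "\<forall>e\<in>edges ?G. e \<subseteq> verts ?G"
    by (auto simp: attach_path_def hypercycle_def cycle_edge_def)
  moreover have "verts ?G \<noteq> {}"
    using assms by (auto simp: attach_path_def)
  ultimately show "is_hypergraph ?G"
    using u assms by (auto simp: is_hypergraph_def uniform_def)
qed

lemma Lop_wellformed:
  assumes "3 \<le> k" "2 \<le> g"
  shows "is_hypergraph (Lop1 g k s)" "uniform k (Lop1 g k s)"
    and "is_hypergraph (Lop2 g k s)" "uniform k (Lop2 g k s)"
proof -
  have "Cyc 1 \<in> verts (hypercycle g k)" "CycIn 1 1 \<in> verts (hypercycle g k)"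
    using assms by (auto simp: hypercycle_def)
  thus "is_hypergraph (Lop1 g k s)" "uniform k (Lop1 g k s)"
    and "is_hypergraph (Lop2 g k s)" "uniform k (Lop2 g k s)"
    unfolding Lop1_def Lop2_def using attach_path_wellformed[OF assms] by blast+
qed

end

theory Submission
  imports Defs "HOL-Analysis.Convex"
begin

text \<open>
  Write \<open>\<rho>\<close> for the spectral radius of the lollipop with a hypercycle of length \<open>g\<close> and \<open>\<mu>\<close> for
  \<open>(k - 1) \<rho>\<close>. By Perron-Frobenius there is a positive function \<open>x\<close> on the vertices such that, at every
  vertex \<open>v\<close>, the sum over the edges \<open>e\<close> through \<open>v\<close> of \<open>(\<Sum>w\<in>e. x w) - x v\<close> equals \<open>\<mu> x v\<close>. From \<open>x\<close> a
  positive function on the lollipop with hypercycle length \<open>g + 1\<close> is built which satisfies these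
  equations with \<open>\<le>\<close> in place of \<open>=\<close> and with \<open><\<close> at some vertex. Pairing it with the Perron vector of
  that longer lollipop shows that its spectral radius is smaller
  (\<open>spectral_radius_less_of_supersolution\<close>).

  To build it, choose among the vertices \<open>v\<^sub>i\<close> of the hypercycle one, \<open>v\<^sub>m\<close>, with the smallest value,
  and split it into two adjacent vertices of the same value, joined by a new edge whose inner
  vertices get the value that makes their equations exact. Eliminating inner vertices shows
  that an edge sum is at least a fixed multiple of the sum of the two values at the ends of the
  edge. By minimality the new edge therefore has the smallest edge sum on the hypercycle
  (\<open>new_sum_le\<close>). Each of the two copies of \<open>v\<^sub>m\<close> has kept one of its old edges and exchanged the other
  for the new one, so its equation can only have gained slack. All other equations are unchanged;
  in particular the pendant path does not notice the splitting.

  Strictness comes from the fact that \<open>\<mu>\<close> exceeds the corresponding number for the hypercycle without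
  its path (\<open>eigenvalue_gt_hypercycle\<close>), which follows by adding the equations over the hypercycle.
  If neither copy had slack, \<open>\<mu>\<close> would satisfy the equation that determines the eigenvalue of the
  bare hypercycle.

  What is used of Perron-Frobenius theory is proved for symmetric nonnegative matrices. The operator
  norm of such a matrix is bounded by its spectral radius (\<open>symmetric_norm_le_spectral_radius\<close>), and
  this turns the moduli of the entries of a complex eigenvector of maximal modulus into a real
  eigenvector.
\<close>

section \<open>Symmetric nonnegative matrices\<close>

text \<open>
  Scaling \<open>A\<close> by \<open>1 / r\<close> brings the spectral radius below \<open>1\<close>, and by the Jordan normal form
  the powers of such a matrix are bounded. The bound is the upper half of Gelfand's formula.
\<close>

lemma spectral_radius_power_bound:
  fixes A :: "complex mat"
  assumes A: "A \<in> carrier_mat n n" and r: "0 < r" "spectral_radius A < r"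
  shows "\<exists>c. \<forall>p i j. i < n \<longrightarrow> j < n \<longrightarrow> cmod ((A ^\<^sub>m p) $$ (i, j)) \<le> c * r ^ p"
proof (cases "n = 0")
  case False
  hence n: "0 < n" by simp
  define t :: complex where "t = complex_of_real (inverse r)"
  have t: "t \<noteq> 0" "cmod t = inverse r" using r by (auto simp: t_def norm_inverse)
  have tA: "t \<cdot>\<^sub>m A \<in> carrier_mat n n" using A by simp
  have "spectral_radius (t \<cdot>\<^sub>m A) < 1"
  proof -
    from spectral_radius_mem_max(1)[OF tA n] obtain l
      where l: "eigenvalue (t \<cdot>\<^sub>m A) l" and sl: "spectral_radius (t \<cdot>\<^sub>m A) = cmod l"
      by (auto simp: spectrum_def)
    from l tA obtain z where z: "z \<in> carrier_vec n" "z \<noteq> 0\<^sub>v n" "(t \<cdot>\<^sub>m A) *\<^sub>v z = l \<cdot>\<^sub>v z"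
      by (auto simp: eigenvalue_def eigenvector_def)
    have "A *\<^sub>v z = (l / t) \<cdot>\<^sub>v z"
    proof (rule eq_vecI)
      fix i assume "i < dim_vec ((l / t) \<cdot>\<^sub>v z)"
      hence i: "i < n" using z by simp
      from z(3) have "((t \<cdot>\<^sub>m A) *\<^sub>v z) $ i = (l \<cdot>\<^sub>v z) $ i" by simp
      hence "t * ((A *\<^sub>v z) $ i) = l * z $ i"
        using i A z(1) by (simp add: scalar_prod_def sum_distrib_left mult.assoc)
      thus "(A *\<^sub>v z) $ i = ((l / t) \<cdot>\<^sub>v z) $ i"
        using t i z(1) by (simp add: field_simps)
    qed (use A z in auto)
    hence "eigenvalue A (l / t)"
      using z A by (auto simp: eigenvalue_def eigenvector_def)
    hence "cmod (l / t) \<le> spectral_radius A"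
      by (intro spectral_radius_mem_max(2)[OF A n]) (auto simp: spectrum_def)
    moreover have "cmod (l / t) = cmod l * r" unfolding norm_divide t(2) by (simp add: divide_inverse)
    ultimately have "cmod l * r < 1 * r" using r by linarith
    thus ?thesis using r(1) sl by (simp only: mult_less_cancel_right_pos)
  qed
  from spectral_radius_jnf_norm_bound_less_1_upper_triangular[OF tA this]
  obtain c where c: "\<And>p. norm_bound ((t \<cdot>\<^sub>m A) ^\<^sub>m p) c" by blast
  have smult_smult: "a \<cdot>\<^sub>m (b \<cdot>\<^sub>m X) = (a * b) \<cdot>\<^sub>m X" for a b and X :: "complex mat"
    by (rule eq_matI) (auto simp: mult.assoc)
  have pow: "(t \<cdot>\<^sub>m A) ^\<^sub>m p = t ^ p \<cdot>\<^sub>m (A ^\<^sub>m p)" for p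
  proof (induction p)
    case (Suc p)
    have "A ^\<^sub>m p \<in> carrier_mat n n" using A by simp
    thus ?case using Suc A
      by (simp add: mult_smult_assoc_mat[of _ n n] mult_smult_distrib[of _ n n] smult_smult ac_simps)
  qed (use A in auto)
  have "cmod ((A ^\<^sub>m p) $$ (i, j)) \<le> c * r ^ p" if "i < n" "j < n" for p i j
  proof -
    have d: "dim_row (A ^\<^sub>m p) = n" "dim_col (A ^\<^sub>m p) = n"
      using pow_carrier_mat[OF A, of p] by auto
    have "cmod (t ^ p * (A ^\<^sub>m p) $$ (i, j)) \<le> c"
      using c[of p] that d unfolding pow norm_bound_def by simp
    thus ?thesis using t r by (simp add: norm_mult norm_power field_simps power_inverse)
  qed
  thus ?thesis by blast
qed simp

text \<open>
  By symmetry the squared norm of \<open>T f\<close> is the inner product of \<open>f\<close> with \<open>T (T f)\<close>, so this is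
  the Cauchy-Schwarz inequality. Along the iterates of \<open>T\<close> it says that the ratios of successive
  norms increase.
\<close>

lemma symmetric_iterates_log_convex:
  fixes B :: "nat \<Rightarrow> nat \<Rightarrow> real" and n :: nat
  assumes sym: "\<And>i j. i < n \<Longrightarrow> j < n \<Longrightarrow> B i j = B j i"
  defines "T \<equiv> \<lambda>f i. \<Sum>j<n. B i j * f j"
  defines "N \<equiv> \<lambda>f. \<Sum>i<n. (f i)\<^sup>2"
  shows "(N (T f))\<^sup>2 \<le> N f * N (T (T f))"
proof -
  have "N (T f) = (\<Sum>i<n. \<Sum>j<n. T f i * (B i j * f j))"
    unfolding N_def by (simp add: power2_eq_square T_def sum_distrib_left)
  also have "\<dots> = (\<Sum>j<n. \<Sum>i<n. T f i * (B i j * f j))"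
    by (rule sum.swap)
  also have "\<dots> = (\<Sum>j<n. f j * T (T f) j)"
  proof (rule sum.cong[OF refl])
    fix j assume "j \<in> {..<n}"
    hence "T (T f) j = (\<Sum>i<n. B i j * T f i)"
      unfolding T_def by (intro sum.cong) (auto simp: sym)
    thus "(\<Sum>i<n. T f i * (B i j * f j)) = f j * T (T f) j"
      by (simp add: sum_distrib_left ac_simps)
  qed
  finally have "N (T f) = (\<Sum>j<n. f j * T (T f) j)" .
  thus ?thesis
    unfolding N_def using Cauchy_Schwarz_ineq_sum[where a = f and b = "T (T f)"] by simp
qed

text \<open>
  The operator norm of a symmetric matrix is at most its spectral radius. If one step of \<open>T\<close>
  stretched the squared norm of \<open>f\<close> by a factor \<open>q > \<rho>\<^sup>2\<close>, log-convexity would make every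
  later step do the same, so that the squared norms of the iterates would grow at least like
  \<open>q ^ p\<close>. They grow at most like \<open>(r\<^sup>2) ^ p\<close> for any \<open>r > \<rho>\<close>, and \<open>r\<close> can be chosen with
  \<open>r\<^sup>2 < q\<close>.
\<close>

lemma symmetric_norm_le_spectral_radius:
  fixes B :: "nat \<Rightarrow> nat \<Rightarrow> real" and n :: nat
  assumes sym: "\<And>i j. i < n \<Longrightarrow> j < n \<Longrightarrow> B i j = B j i" and n: "0 < n"
  defines "\<rho> \<equiv> spectral_radius (mat n n (\<lambda>(i, j). complex_of_real (B i j)))"
  shows "(\<Sum>i<n. (\<Sum>j<n. B i j * f j)\<^sup>2) \<le> \<rho>\<^sup>2 * (\<Sum>i<n. (f i)\<^sup>2)"
proof (rule ccontr)
  define T where "T = (\<lambda>f i. \<Sum>j<n. B i j * f j)"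
  define N where "N = (\<lambda>f::nat \<Rightarrow> real. \<Sum>i<n. (f i)\<^sup>2)"
  define M where "M = mat n n (\<lambda>(i, j). complex_of_real (B i j))"
  have M: "M \<in> carrier_mat n n" by (simp add: M_def)
  have \<rho>: "0 \<le> \<rho>" using spectral_radius_mem_max(1)[OF M n] by (auto simp: \<rho>_def M_def)
  assume "\<not> ?thesis"
  hence gt: "\<rho>\<^sup>2 * N f < N (T f)" by (simp add: N_def T_def)
  have Nnn: "0 \<le> N h" for h unfolding N_def by (intro sum_nonneg) simp
  have N0: "0 < N f"
  proof (rule ccontr)
    assume "\<not> 0 < N f"
    hence "N f = 0" using Nnn[of f] by simp
    hence "\<forall>i<n. f i = 0" unfolding N_def by (subst (asm) sum_nonneg_eq_0_iff) auto
    hence "N (T f) = 0" unfolding N_def T_def by simp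
    thus False using gt \<open>N f = 0\<close> by simp
  qed
  define q where "q = N (T f) / N f"
  have q: "\<rho>\<^sup>2 < q" using gt N0 by (simp add: q_def field_simps)
  have low: "0 < N ((T ^^ p) f) \<and> q * N ((T ^^ p) f) \<le> N ((T ^^ Suc p) f)" for p
  proof (induction p)
    case 0
    show ?case using N0 by (simp add: q_def)
  next
    case (Suc p)
    have q0: "0 < q" using q by (meson le_less_trans zero_le_power2)
    let ?a = "N ((T ^^ p) f)" and ?b = "N ((T ^^ Suc p) f)" and ?c = "N ((T ^^ Suc (Suc p)) f)"
    have b: "0 < ?b" using Suc q0 by (meson less_le_trans mult_pos_pos)
    have "?b\<^sup>2 \<le> ?a * ?c"
      using symmetric_iterates_log_convex[of n B "(T ^^ p) f", OF sym] by (simp add: T_def N_def)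
    moreover have "?b * (q * ?a) \<le> ?b * ?b" using Suc b by (intro mult_left_mono) auto
    ultimately have "?a * (q * ?b) \<le> ?a * ?c" by (simp add: power2_eq_square ac_simps)
    thus ?case using Suc b by simp
  qed
  have low': "q ^ p * N f \<le> N ((T ^^ p) f)" for p
  proof (induction p)
    case (Suc p)
    have "0 \<le> q" using q by (meson le_less_trans less_imp_le zero_le_power2)
    hence "q * (q ^ p * N f) \<le> q * N ((T ^^ p) f)" using Suc by (intro mult_left_mono) auto
    thus ?case using low[of p] by (simp add: ac_simps)
  qed simp
  \<comment> \<open>any \<open>r\<close> with \<open>\<rho>\<^sup>2 < r\<^sup>2 < q\<close> separates the two growth rates\<close>
  define r where "r = sqrt ((\<rho>\<^sup>2 + q) / 2)"
  have q0: "0 < q" by (rule le_less_trans[OF zero_le_power2 q])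
  hence r2: "r\<^sup>2 = (\<rho>\<^sup>2 + q) / 2" by (simp add: r_def)
  have r: "0 < r" "\<rho> < r" "r\<^sup>2 < q"
  proof -
    show "0 < r" unfolding r_def using q0 by (simp add: add_nonneg_pos)
    show "\<rho> < r" unfolding r_def by (rule real_less_rsqrt) (use q in simp)
    show "r\<^sup>2 < q" using r2 q by simp
  qed
  from spectral_radius_power_bound[OF M r(1)] r(2)
  obtain c where c: "\<And>p i j. i < n \<Longrightarrow> j < n \<Longrightarrow> cmod ((M ^\<^sub>m p) $$ (i, j)) \<le> c * r ^ p"
    by (auto simp: M_def \<rho>_def)
  define v where "v = (\<lambda>f. vec n (\<lambda>i. complex_of_real (f i)))"
  have vT: "v ((T ^^ p) f) = (M ^\<^sub>m p) *\<^sub>v v f" for p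
  proof (induction p)
    case 0
    show ?case using M by (simp add: v_def)
  next
    case (Suc p)
    have step: "v (T h) = M *\<^sub>v v h" for h
      by (rule eq_vecI) (auto simp: v_def T_def M_def scalar_prod_def atLeast0LessThan)
    have "M ^\<^sub>m Suc p = M * M ^\<^sub>m p"
    proof (induction p)
      case (Suc p)
      hence "M ^\<^sub>m Suc (Suc p) = (M * M ^\<^sub>m p) * M" by simp
      thus ?case using M by (simp add: assoc_mult_mat[of _ n n _ n _ n])
    qed (use M in simp)
    thus ?case using Suc step[of "(T ^^ p) f"] M by (simp add: v_def assoc_mult_mat_vec[of _ n n _ n])
  qed
  define D where "D = c * (\<Sum>j<n. \<bar>f j\<bar>)"
  have up: "\<bar>(T ^^ p) f i\<bar> \<le> D * r ^ p" if i: "i < n" for i p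
  proof -
    have Mp: "M ^\<^sub>m p \<in> carrier_mat n n" using M by simp
    have "complex_of_real ((T ^^ p) f i) = v ((T ^^ p) f) $ i" using i by (simp add: v_def)
    also have "\<dots> = (\<Sum>j<n. (M ^\<^sub>m p) $$ (i, j) * complex_of_real (f j))"
      unfolding vT using i carrier_matD[OF Mp] by (simp add: scalar_prod_def v_def atLeast0LessThan)
    finally have "\<bar>(T ^^ p) f i\<bar> = cmod (\<Sum>j<n. (M ^\<^sub>m p) $$ (i, j) * complex_of_real (f j))"
      by (metis norm_of_real real_norm_def)
    also have "\<dots> \<le> (\<Sum>j<n. (c * r ^ p) * \<bar>f j\<bar>)"
      by (intro sum_norm_le) (auto simp: norm_mult intro!: mult_right_mono c i)
    finally show ?thesis by (simp add: D_def sum_distrib_left ac_simps)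
  qed
  have up': "N ((T ^^ p) f) \<le> real n * D\<^sup>2 * (r\<^sup>2) ^ p" for p
  proof -
    have "N ((T ^^ p) f) \<le> (\<Sum>i<n. (D * r ^ p)\<^sup>2)"
      unfolding N_def
    proof (rule sum_mono)
      fix i assume "i \<in> {..<n}"
      hence "\<bar>(T ^^ p) f i\<bar>\<^sup>2 \<le> (D * r ^ p)\<^sup>2" by (intro power_mono up) auto
      thus "((T ^^ p) f i)\<^sup>2 \<le> (D * r ^ p)\<^sup>2" by simp
    qed
    thus ?thesis by (simp add: power_mult_distrib power_mult[symmetric] ac_simps)
  qed
  have "(q / r\<^sup>2) ^ p \<le> real n * D\<^sup>2 / N f" for p
    using order_trans[OF low'[of p] up'[of p]] N0 r(1) by (simp add: field_simps power_divide)
  moreover have "1 < q / r\<^sup>2" using r by (simp add: field_simps)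
  ultimately show False using real_arch_pow[of "q / r\<^sup>2" "real n * D\<^sup>2 / N f"] by (meson not_le)
qed

text \<open>
  The Perron-Frobenius theorem in its weak form. If \<open>z\<close> is a complex eigenvector for an eigenvalue
  of modulus \<open>\<rho>\<close>, the triangle inequality gives \<open>\<rho> w \<le> B w\<close> entrywise for the vector \<open>w\<close> of moduli.
  Since the norm of \<open>B w\<close> is at most \<open>\<rho>\<close> times that of \<open>w\<close>, none of these inequalities is strict.
\<close>

lemma symmetric_nonneg_perron:
  fixes B :: "nat \<Rightarrow> nat \<Rightarrow> real" and n :: nat
  assumes sym: "\<And>i j. i < n \<Longrightarrow> j < n \<Longrightarrow> B i j = B j i"
    and nonneg: "\<And>i j. i < n \<Longrightarrow> j < n \<Longrightarrow> 0 \<le> B i j" and n: "0 < n"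
  defines "\<rho> \<equiv> spectral_radius (mat n n (\<lambda>(i, j). complex_of_real (B i j)))"
  shows "\<exists>w. (\<forall>i<n. 0 \<le> w i) \<and> (\<exists>i<n. 0 < w i) \<and> (\<forall>i<n. (\<Sum>j<n. B i j * w j) = \<rho> * w i)"
proof -
  define M where "M = mat n n (\<lambda>(i, j). complex_of_real (B i j))"
  have M: "M \<in> carrier_mat n n" by (simp add: M_def)
  from spectral_radius_mem_max(1)[OF M n] obtain l
    where l: "eigenvalue M l" "\<rho> = cmod l" by (auto simp: spectrum_def \<rho>_def M_def)
  then obtain z where z: "z \<in> carrier_vec n" "z \<noteq> 0\<^sub>v n" "M *\<^sub>v z = l \<cdot>\<^sub>v z"
    using M by (auto simp: eigenvalue_def eigenvector_def)
  define w where "w = (\<lambda>i. cmod (z $ i))"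
  have sub: "\<rho> * w i \<le> (\<Sum>j<n. B i j * w j)" if i: "i < n" for i
  proof -
    have "l * z $ i = (M *\<^sub>v z) $ i" using z i by simp
    also have "\<dots> = (\<Sum>j<n. complex_of_real (B i j) * z $ j)"
      using i z(1) by (simp add: M_def scalar_prod_def atLeast0LessThan)
    finally have "\<rho> * w i = cmod (\<Sum>j<n. complex_of_real (B i j) * z $ j)"
      unfolding l w_def by (simp flip: norm_mult)
    also have "\<dots> \<le> (\<Sum>j<n. B i j * w j)"
      by (intro sum_norm_le) (auto simp: norm_mult w_def nonneg i)
    finally show ?thesis .
  qed
  have nn: "0 \<le> \<rho> * w i" for i using l by (simp add: w_def)
  have sq: "(\<rho> * w i)\<^sup>2 \<le> (\<Sum>j<n. B i j * w j)\<^sup>2" if "i < n" for i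
    using sub[OF that] nn by (rule power_mono)
  have "(\<Sum>i<n. (\<Sum>j<n. B i j * w j)\<^sup>2 - (\<rho> * w i)\<^sup>2) \<le> 0"
    using symmetric_norm_le_spectral_radius[of n B w, OF sym n]
    by (simp add: sum_subtractf power_mult_distrib sum_distrib_left \<rho>_def)
  moreover have "0 \<le> (\<Sum>i<n. (\<Sum>j<n. B i j * w j)\<^sup>2 - (\<rho> * w i)\<^sup>2)"
    using sq by (intro sum_nonneg) auto
  ultimately have "(\<Sum>i<n. (\<Sum>j<n. B i j * w j)\<^sup>2 - (\<rho> * w i)\<^sup>2) = 0" by simp
  hence "\<forall>i<n. (\<Sum>j<n. B i j * w j)\<^sup>2 = (\<rho> * w i)\<^sup>2"
    using sq by (subst (asm) sum_nonneg_eq_0_iff) auto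
  hence "\<forall>i<n. (\<Sum>j<n. B i j * w j) = \<rho> * w i"
    using sub nn by (meson order_trans power2_eq_imp_eq)
  moreover have "\<exists>i<n. 0 < w i"
    using z(1,2) by (auto simp: w_def vec_eq_iff)
  ultimately show ?thesis by (intro exI[of _ w]) (auto simp: w_def)
qed

section \<open>The adjacency operator of a uniform hypergraph\<close>

text \<open>
  On a \<open>k\<close>-uniform hypergraph this is \<open>k - 1\<close> times the adjacency operator. It is written with
  edge sums because the proof modifies one edge and only has to compare such sums.
\<close>

definition edge_op :: "'a hypergraph \<Rightarrow> ('a \<Rightarrow> real) \<Rightarrow> 'a \<Rightarrow> real" where
  "edge_op G f v = (\<Sum>e | e \<in> edges G \<and> v \<in> e. sum f e - f v)"

text \<open>
  Connectedness in the form in which positivity of an eigenvector uses it: a union of connected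
  components is everything or empty.
\<close>

definition hg_connected :: "'a hypergraph \<Rightarrow> bool" where
  "hg_connected G \<longleftrightarrow> (\<forall>Z\<subseteq>verts G. Z \<noteq> {} \<longrightarrow> (\<forall>e\<in>edges G. e \<inter> Z \<noteq> {} \<longrightarrow> e \<subseteq> Z) \<longrightarrow> Z = verts G)"

lemma is_hypergraph_finite:
  assumes "is_hypergraph G"
  shows "finite (verts G)" "finite (edges G)" "e \<in> edges G \<Longrightarrow> finite e"
proof -
  show V: "finite (verts G)" using assms by (simp add: is_hypergraph_def)
  have "edges G \<subseteq> Pow (verts G)" using assms by (auto simp: is_hypergraph_def)
  thus "finite (edges G)" using V finite_subset by blast
  show "finite e" if "e \<in> edges G"
    using that assms V finite_subset by (auto simp: is_hypergraph_def)
qed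

lemma adjacency_sym: "adjacency G i j = adjacency G j i"
  by (auto simp: adjacency_def intro!: sum.cong)

lemma adjacency_nonneg:
  assumes "is_hypergraph G" shows "0 \<le> adjacency G i j"
  using assms by (auto simp: adjacency_def is_hypergraph_def intro!: sum_nonneg)

lemma adjacency_apply:
  assumes G: "is_hypergraph G" "uniform k G"
  shows "(\<Sum>u\<in>verts G. adjacency G v u * f u) = edge_op G f v / (real k - 1)"
proof -
  let ?E = "{e \<in> edges G. v \<in> e}"
  note fin = is_hypergraph_finite[OF G(1)]
  have E: "finite ?E" using fin by simp
  have "(\<Sum>u\<in>verts G. adjacency G v u * f u)
      = (\<Sum>u\<in>verts G. \<Sum>e\<in>?E. if u \<in> e - {v} then f u / (real k - 1) else 0)"
  proof (rule sum.cong[OF refl])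
    fix u
    have "adjacency G v u * f u = (\<Sum>e | e \<in> ?E \<and> u \<in> e - {v}. f u / (real k - 1))"
      using G(2) by (auto simp: adjacency_def uniform_def sum_distrib_right intro!: sum.cong)
    also have "\<dots> = (\<Sum>e\<in>?E. if u \<in> e - {v} then f u / (real k - 1) else 0)"
      using E by (simp only: sum.inter_filter)
    finally show "adjacency G v u * f u = \<dots>" .
  qed
  also have "\<dots> = (\<Sum>e\<in>?E. \<Sum>u\<in>verts G. if u \<in> e - {v} then f u / (real k - 1) else 0)"
    by (rule sum.swap)
  also have "\<dots> = (\<Sum>e\<in>?E. (sum f e - f v) / (real k - 1))"
  proof (rule sum.cong[OF refl])
    fix e assume e: "e \<in> ?E"
    have "verts G \<inter> (e - {v}) = e - {v}" using e G(1) by (auto simp: is_hypergraph_def)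
    hence "(\<Sum>u\<in>verts G. if u \<in> e - {v} then f u / (real k - 1) else 0)
        = (\<Sum>u\<in>e - {v}. f u / (real k - 1))"
      using sum.inter_restrict[OF fin(1), of "\<lambda>u. f u / (real k - 1)" "e - {v}"] by simp
    also have "\<dots> = (sum f e - f v) / (real k - 1)"
      using e fin(3) by (simp add: sum_diff1 flip: sum_divide_distrib)
    finally show "(\<Sum>u\<in>verts G. if u \<in> e - {v} then f u / (real k - 1) else 0) = \<dots>" .
  qed
  finally show ?thesis by (simp add: edge_op_def sum_divide_distrib)
qed

lemma edge_op_self_adjoint:
  assumes "is_hypergraph G" "uniform k G" "2 \<le> k"
  shows "(\<Sum>v\<in>verts G. f v * edge_op G h v) = (\<Sum>v\<in>verts G. edge_op G f v * h v)"
proof -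
  have op: "edge_op G f v = (real k - 1) * (\<Sum>u\<in>verts G. adjacency G v u * f u)" for f v
    using adjacency_apply[OF assms(1,2), of v f] assms(3) by simp
  have "(\<Sum>v\<in>verts G. f v * edge_op G h v)
      = (\<Sum>v\<in>verts G. \<Sum>u\<in>verts G. (real k - 1) * (adjacency G v u * f v * h u))"
    unfolding op by (simp add: sum_distrib_left ac_simps)
  also have "\<dots> = (\<Sum>u\<in>verts G. \<Sum>v\<in>verts G. (real k - 1) * (adjacency G v u * f v * h u))"
    by (rule sum.swap)
  also have "\<dots> = (\<Sum>u\<in>verts G. edge_op G f u * h u)"
    unfolding op by (simp add: sum_distrib_left sum_distrib_right ac_simps adjacency_sym)
  finally show ?thesis .
qed

lemma hypergraph_perron:
  assumes G: "is_hypergraph G" "uniform k G" "2 \<le> k"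
  shows "\<exists>w. (\<forall>v\<in>verts G. 0 \<le> w v) \<and> (\<exists>v\<in>verts G. 0 < w v) \<and>
    (\<forall>v\<in>verts G. edge_op G w v = (real k - 1) * hg_spectral_radius G * w v)"
proof -
  define n where "n = card (verts G)"
  define h where "h = from_nat_into (verts G)"
  define B where "B = (\<lambda>i j. adjacency G (h i) (h j))"
  have fin: "finite (verts G)" and n: "0 < n"
    using G(1) by (auto simp: n_def is_hypergraph_def card_gt_0_iff)
  have bij: "bij_betw h {..<n} (verts G)"
    unfolding h_def n_def by (rule bij_betw_from_nat_into_finite[OF fin])
  have "map_mat complex_of_real (adjacency_matrix G) = mat n n (\<lambda>(i, j). complex_of_real (B i j))"
    by (rule eq_matI) (auto simp: adjacency_matrix_def n_def B_def h_def)
  hence rho: "hg_spectral_radius G = spectral_radius (mat n n (\<lambda>(i, j). complex_of_real (B i j)))"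
    by (simp add: hg_spectral_radius_def)
  have "\<exists>w. (\<forall>i<n. 0 \<le> w i) \<and> (\<exists>i<n. 0 < w i) \<and>
      (\<forall>i<n. (\<Sum>j<n. B i j * w j) = hg_spectral_radius G * w i)"
    unfolding rho by (rule symmetric_nonneg_perron)
      (auto simp: B_def adjacency_nonneg[OF G(1)] n intro: adjacency_sym)
  then obtain w where w: "\<And>i. i < n \<Longrightarrow> 0 \<le> w i" "\<exists>i<n. 0 < w i"
      "\<And>i. i < n \<Longrightarrow> (\<Sum>j<n. B i j * w j) = hg_spectral_radius G * w i" by blast
  define x where "x = w \<circ> the_inv_into {..<n} h"
  have x: "x (h i) = w i" if "i < n" for i
    using that bij by (simp add: x_def the_inv_into_f_f bij_betw_def)
  have V: "v \<in> verts G \<longleftrightarrow> (\<exists>i<n. v = h i)" for v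
    using bij by (auto simp: bij_betw_def)
  have "edge_op G x (h i) = (real k - 1) * hg_spectral_radius G * x (h i)" if i: "i < n" for i
  proof -
    have "(\<Sum>u\<in>verts G. adjacency G (h i) u * x u) = (\<Sum>j<n. adjacency G (h i) (h j) * x (h j))"
      by (rule sum.reindex_bij_betw[OF bij, symmetric])
    also have "\<dots> = hg_spectral_radius G * w i"
      using w(3)[OF i] by (simp add: x B_def)
    finally show ?thesis
      using adjacency_apply[OF G(1,2), of "h i" x] G(3) by (simp add: x[OF i] field_simps)
  qed
  moreover have "\<exists>v\<in>verts G. 0 < x v" using w(2) x V by metis
  ultimately show ?thesis using w(1) by (intro exI[of _ x]) (auto simp: V x)
qed

text \<open>
  An eigenvector that is nonnegative and vanishes at \<open>v\<close> has edge sum zero on every edge through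
  \<open>v\<close>, hence vanishes on all these edges. Its support is therefore a union of components.
\<close>

lemma hypergraph_perron_positive:
  assumes G: "is_hypergraph G" "uniform k G" "2 \<le> k" "hg_connected G"
  shows "\<exists>w. (\<forall>v\<in>verts G. 0 < w v) \<and>
    (\<forall>v\<in>verts G. edge_op G w v = (real k - 1) * hg_spectral_radius G * w v)"
proof -
  from hypergraph_perron[OF G(1-3)] obtain w where w: "\<And>v. v \<in> verts G \<Longrightarrow> 0 \<le> w v"
    "\<exists>v\<in>verts G. 0 < w v"
    "\<And>v. v \<in> verts G \<Longrightarrow> edge_op G w v = (real k - 1) * hg_spectral_radius G * w v" by blast
  note fin = is_hypergraph_finite[OF G(1)]
  let ?Z = "{v \<in> verts G. 0 < w v}"
  have "e \<subseteq> ?Z" if e: "e \<in> edges G" "e \<inter> ?Z \<noteq> {}" for e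
  proof (rule ccontr)
    assume "\<not> e \<subseteq> ?Z"
    then obtain v where v: "v \<in> e" "v \<notin> ?Z" by blast
    have eV: "e' \<subseteq> verts G" if "e' \<in> edges G" for e' using that G(1) by (auto simp: is_hypergraph_def)
    have wv: "w v = 0" "v \<in> verts G" using v eV[OF e(1)] w(1)[of v] by auto
    have "edge_op G w v = 0" using w(3) wv by simp
    hence "(\<Sum>e | e \<in> edges G \<and> v \<in> e. sum w e) = 0" by (simp add: edge_op_def wv)
    moreover have "0 \<le> sum w e'" if "e' \<in> edges G" for e'
      using eV[OF that] w(1) by (intro sum_nonneg) auto
    ultimately have "\<forall>e'\<in>{e \<in> edges G. v \<in> e}. sum w e' = 0"
      using fin(2) by (subst (asm) sum_nonneg_eq_0_iff) auto
    hence "sum w e = 0" using e v by simp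
    moreover have "0 < sum w e"
    proof -
      from e(2) obtain u where "u \<in> e" "0 < w u" by blast
      thus ?thesis using fin(3)[OF e(1)] eV[OF e(1)] w(1) by (intro sum_pos2[of e u]) auto
    qed
    ultimately show False by simp
  qed
  moreover have "?Z \<noteq> {}" "?Z \<subseteq> verts G" using w(2) by auto
  ultimately have "?Z = verts G" by (intro G(4)[unfolded hg_connected_def, rule_format])
  thus ?thesis using w(3) by (intro exI[of _ w]) auto
qed

text \<open>
  The test for an upper bound: pairing \<open>y\<close> with the positive Perron vector \<open>w\<close> and using
  self-adjointness turns the pointwise inequalities into an inequality between \<open>\<mu>\<close> and the
  eigenvalue of \<open>w\<close>. As \<open>w\<close> has no zeros, strictness at a single vertex survives.
\<close>

lemma spectral_radius_less_of_supersolution: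
  assumes G: "is_hypergraph G" "uniform k G" "2 \<le> k" "hg_connected G"
    and pos: "\<And>v. v \<in> verts G \<Longrightarrow> 0 < y v"
    and le: "\<And>v. v \<in> verts G \<Longrightarrow> edge_op G y v \<le> \<mu> * y v"
    and less: "\<exists>v\<in>verts G. edge_op G y v < \<mu> * y v"
  shows "(real k - 1) * hg_spectral_radius G < \<mu>"
proof -
  from hypergraph_perron_positive[OF G] obtain w where w: "\<And>v. v \<in> verts G \<Longrightarrow> 0 < w v"
    "\<And>v. v \<in> verts G \<Longrightarrow> edge_op G w v = (real k - 1) * hg_spectral_radius G * w v" by blast
  have fin: "finite (verts G)" "verts G \<noteq> {}" using G(1) by (auto simp: is_hypergraph_def)
  let ?p = "\<Sum>v\<in>verts G. w v * y v"
  have p: "0 < ?p" using fin w(1) pos by (intro sum_pos) auto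
  have "(real k - 1) * hg_spectral_radius G * ?p = (\<Sum>v\<in>verts G. edge_op G w v * y v)"
    by (simp add: sum_distrib_left w(2) mult.assoc)
  also have "\<dots> = (\<Sum>v\<in>verts G. w v * edge_op G y v)"
    by (rule edge_op_self_adjoint[OF G(1-3), symmetric])
  also have "\<dots> < (\<Sum>v\<in>verts G. w v * (\<mu> * y v))"
    using fin le less w(1) by (intro sum_strict_mono_ex1) (auto simp: less_imp_le)
  also have "\<dots> = \<mu> * ?p" by (simp add: sum_distrib_left ac_simps)
  finally show ?thesis using p by (simp only: mult_less_cancel_right_pos)
qed

section \<open>Edges and connectedness of lollipops\<close>

text \<open>
  The part of \<open>edge_op\<close> that comes from the pendant path. It does not mention the length of the
  hypercycle, so it is literally the same for two lollipops that differ only in that length, and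
  the path never has to be analysed.
\<close>

definition path_op :: "vertex \<Rightarrow> nat \<Rightarrow> nat \<Rightarrow> (vertex \<Rightarrow> real) \<Rightarrow> vertex \<Rightarrow> real" where
  "path_op u k s f v = (\<Sum>i | i \<in> {1..s} \<and> v \<in> path_edge u k i. sum f (path_edge u k i) - f v)"

definition cyclic_pred :: "nat \<Rightarrow> nat \<Rightarrow> nat" where
  "cyclic_pred g i = (if i = 1 then g else i - 1)"

lemma sum_cycle_edge:
  assumes "2 \<le> g" "1 \<le> i" "i \<le> g"
  shows "sum f (cycle_edge g k i) =
    f (Cyc i) + f (Cyc (if i = g then 1 else i + 1)) + (\<Sum>j = 1..k - 2. f (CycIn i j))"
proof -
  have "sum f (cycle_edge g k i)
      = sum f {Cyc i, Cyc (if i = g then 1 else i + 1)} + sum f (CycIn i ` {1..k - 2})"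
    unfolding cycle_edge_def by (rule sum.union_disjoint) auto
  moreover have "sum f (CycIn i ` {1..k - 2}) = (\<Sum>j = 1..k - 2. f (CycIn i j))"
    by (subst sum.reindex) (auto simp: inj_on_def)
  moreover have "sum f {Cyc i, Cyc (if i = g then 1 else i + 1)}
      = f (Cyc i) + f (Cyc (if i = g then 1 else i + 1))"
    using assms by simp
  ultimately show ?thesis by simp
qed

lemma edge_op_lollipop:
  assumes "3 \<le> k" "u \<in> verts (hypercycle g k)"
  shows "edge_op (attach_path (hypercycle g k) u k s) f v =
    (\<Sum>i | i \<in> {1..g} \<and> v \<in> cycle_edge g k i. sum f (cycle_edge g k i) - f v) + path_op u k s f v"
proof -
  let ?C = "{i \<in> {1..g}. v \<in> cycle_edge g k i}" and ?P = "{i \<in> {1..s}. v \<in> path_edge u k i}"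
  have CycIn_in: "CycIn i 1 \<in> cycle_edge g k j \<longleftrightarrow> i = j" for i j
    using assms(1) by (auto simp: cycle_edge_def)
  have injC: "inj_on (cycle_edge g k) ?C"
    by (rule inj_onI) (metis CycIn_in)
  have injP: "inj_on (path_edge u k) ?P"
    using hyperpath_path_edge[OF assms(2), of s] unfolding hyperpath_def inj_on_def by blast
  have "PthIn i 1 \<in> path_edge u k i" "PthIn i 1 \<notin> cycle_edge g k j" for i j
    using assms(1) by (auto simp: path_edge_def cycle_edge_def)
  hence disj: "cycle_edge g k ` ?C \<inter> path_edge u k ` ?P = {}" by blast
  have "{e \<in> edges (attach_path (hypercycle g k) u k s). v \<in> e}
      = cycle_edge g k ` ?C \<union> path_edge u k ` ?P"
    by (auto simp: attach_path_def hypercycle_def)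
  hence "edge_op (attach_path (hypercycle g k) u k s) f v
      = (\<Sum>e\<in>cycle_edge g k ` ?C \<union> path_edge u k ` ?P. sum f e - f v)"
    by (simp only: edge_op_def)
  also have "\<dots> = (\<Sum>e\<in>cycle_edge g k ` ?C. sum f e - f v) + (\<Sum>e\<in>path_edge u k ` ?P. sum f e - f v)"
    by (rule sum.union_disjoint[OF _ _ disj]) simp_all
  finally show ?thesis
    by (simp only: sum.reindex[OF injC] sum.reindex[OF injP] o_def path_op_def)
qed

lemma edge_op_Cyc:
  assumes "3 \<le> k" "u \<in> verts (hypercycle g k)" "2 \<le> g" "1 \<le> i" "i \<le> g"
  shows "edge_op (attach_path (hypercycle g k) u k s) f (Cyc i) =
    sum f (cycle_edge g k i) + sum f (cycle_edge g k (cyclic_pred g i)) - 2 * f (Cyc i)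
      + path_op u k s f (Cyc i)"
proof -
  have "{j \<in> {1..g}. Cyc i \<in> cycle_edge g k j} = {i, cyclic_pred g i}"
    using assms(3-5) by (auto simp: cycle_edge_def cyclic_pred_def split: if_splits)
  moreover have "i \<noteq> cyclic_pred g i" using assms(3-5) by (auto simp: cyclic_pred_def)
  ultimately show ?thesis using edge_op_lollipop[OF assms(1,2), of s f "Cyc i"] by simp
qed

lemma edge_op_CycIn:
  assumes "3 \<le> k" "u \<in> verts (hypercycle g k)" "i \<in> {1..g}" "j \<in> {1..k - 2}"
  shows "edge_op (attach_path (hypercycle g k) u k s) f (CycIn i j) =
    sum f (cycle_edge g k i) - f (CycIn i j) + path_op u k s f (CycIn i j)"
proof -
  have "{l \<in> {1..g}. CycIn i j \<in> cycle_edge g k l} = {i}"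
    using assms(3,4) by (auto simp: cycle_edge_def)
  thus ?thesis using edge_op_lollipop[OF assms(1,2), of s f "CycIn i j"] by simp
qed

lemma edge_op_path:
  assumes "3 \<le> k" "u \<in> verts (hypercycle g k)" "\<And>i. v \<noteq> Cyc i" "\<And>i j. v \<noteq> CycIn i j"
  shows "edge_op (attach_path (hypercycle g k) u k s) f v = path_op u k s f v"
proof -
  have "{l \<in> {1..g}. v \<in> cycle_edge g k l} = {}"
    using assms(3,4) by (auto simp: cycle_edge_def)
  thus ?thesis using edge_op_lollipop[OF assms(1,2), of s f v] by (simp only: sum.empty add_0_left)
qed

lemma path_op_eq_0:
  assumes "\<And>i. 1 \<le> i \<Longrightarrow> v \<notin> path_edge u k i"
  shows "path_op u k s f v = 0"
proof -
  have "{i \<in> {1..s}. v \<in> path_edge u k i} = {}" using assms by auto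
  thus ?thesis by (simp only: path_op_def sum.empty)
qed

lemma path_op_cong:
  assumes "\<And>i w. 1 \<le> i \<Longrightarrow> w \<in> path_edge u k i \<Longrightarrow> f w = h w"
  shows "path_op u k s f v = path_op u k s h v"
  unfolding path_op_def
proof (intro sum.cong refl)
  fix i assume "i \<in> {i \<in> {1..s}. v \<in> path_edge u k i}"
  hence i: "1 \<le> i" "v \<in> path_edge u k i" by auto
  have "sum f (path_edge u k i) = sum h (path_edge u k i)"
    using assms i(1) by (intro sum.cong) auto
  thus "sum f (path_edge u k i) - f v = sum h (path_edge u k i) - h v"
    using assms[OF i] by simp
qed

lemma path_op_nonneg:
  assumes "\<And>i w. i \<in> {1..s} \<Longrightarrow> w \<in> path_edge u k i \<Longrightarrow> 0 \<le> f w"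
  shows "0 \<le> path_op u k s f v"
  unfolding path_op_def
proof (rule sum_nonneg)
  fix i assume "i \<in> {i \<in> {1..s}. v \<in> path_edge u k i}"
  hence i: "i \<in> {1..s}" "v \<in> path_edge u k i" by auto
  have "f v \<le> sum f (path_edge u k i)"
    using assms i by (intro member_le_sum) (auto simp: path_edge_def)
  thus "0 \<le> sum f (path_edge u k i) - f v" by simp
qed

lemma path_op_attachment_pos:
  assumes "3 \<le> k" "1 \<le> s" "u \<in> verts (hypercycle g k)"
    and pos: "\<And>i w. i \<in> {1..s} \<Longrightarrow> w \<in> path_edge u k i \<Longrightarrow> 0 < f w"
  shows "0 < path_op u k s f u"
proof -
  have "{i \<in> {1..s}. u \<in> path_edge u k i} = {1}"
    using assms(2,3) by (auto simp: path_edge_def path_vertex_def hypercycle_def split: if_splits)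
  moreover have "f u < sum f (path_edge u k 1)"
  proof -
    have in1: "PthIn 1 1 \<in> path_edge u k 1" "u \<in> path_edge u k 1" "PthIn 1 1 \<noteq> u"
      using assms(1,3) by (auto simp: path_edge_def path_vertex_def hypercycle_def)
    have "sum f {u, PthIn 1 1} \<le> sum f (path_edge u k 1)"
      using in1 assms(2) pos[of 1] by (intro sum_mono2) (auto simp: path_edge_def less_imp_le)
    thus ?thesis using in1 assms(2) pos[of 1 "PthIn 1 1"] by simp
  qed
  ultimately show ?thesis by (simp add: path_op_def)
qed

text \<open>
  Membership in a union \<open>Z\<close> of components is passed along the cycle upwards from any edge to edge
  \<open>g\<close>, then through \<open>v\<^sub>1\<close> to edge \<open>1\<close> and on to all edges; along the path it is first passed down to
  the attachment vertex and then back up.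
\<close>

lemma lollipop_connected:
  assumes k: "3 \<le> k" and g: "2 \<le> g" and s: "1 \<le> s" and u: "u \<in> verts (hypercycle g k)"
  shows "hg_connected (attach_path (hypercycle g k) u k s)"
  unfolding hg_connected_def
proof (intro allI impI)
  let ?G = "attach_path (hypercycle g k) u k s"
  fix Z assume Z: "Z \<subseteq> verts ?G" "Z \<noteq> {}" "\<forall>e\<in>edges ?G. e \<inter> Z \<noteq> {} \<longrightarrow> e \<subseteq> Z"
  have cyc: "cycle_edge g k i \<subseteq> Z" if "i \<in> {1..g}" "v \<in> cycle_edge g k i" "v \<in> Z" for i v
    using Z(3) that by (auto simp: attach_path_def hypercycle_def)
  have pth: "path_edge u k i \<subseteq> Z" if "i \<in> {1..s}" "v \<in> path_edge u k i" "v \<in> Z" for i v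
    using Z(3) that by (auto simp: attach_path_def)
  have cover: "\<exists>i\<in>{1..g}. v \<in> cycle_edge g k i" if "v \<in> verts (hypercycle g k)" for v
  proof -
    from that consider i where "i \<in> {1..g}" "v = Cyc i"
      | i j where "i \<in> {1..g}" "j \<in> {1..k - 2}" "v = CycIn i j"
      by (auto simp: hypercycle_def)
    thus ?thesis
    proof cases
      case 1
      thus ?thesis by (intro bexI[of _ i]) (simp_all add: cycle_edge_def)
    next
      case 2
      thus ?thesis by (intro bexI[of _ i]) (simp_all add: cycle_edge_def)
    qed
  qed
  have rise: "cycle_edge g k (i + l) \<subseteq> Z" if "cycle_edge g k i \<subseteq> Z" "1 \<le> i" "i + l \<le> g" for i l
    using that(3)
  proof (induction l)
    case (Suc l)
    hence "Cyc (i + Suc l) \<in> cycle_edge g k (i + l)" by (simp add: cycle_edge_def)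
    moreover have "Cyc (i + Suc l) \<in> cycle_edge g k (i + Suc l)" by (simp add: cycle_edge_def)
    ultimately show ?case using Suc that(2) cyc[of "i + Suc l"] by auto
  qed (use that in simp)
  have all_cyc: "verts (hypercycle g k) \<subseteq> Z" if v: "v \<in> verts (hypercycle g k)" "v \<in> Z" for v
  proof -
    from cover[OF v(1)] obtain i where i: "i \<in> {1..g}" "v \<in> cycle_edge g k i" by blast
    have "cycle_edge g k g \<subseteq> Z" using rise[of i "g - i"] cyc[OF i v(2)] i(1) by simp
    hence "Cyc 1 \<in> Z" by (auto simp: cycle_edge_def)
    hence "cycle_edge g k 1 \<subseteq> Z" using g by (intro cyc[of 1 "Cyc 1"]) (auto simp: cycle_edge_def)
    hence "cycle_edge g k j \<subseteq> Z" if "j \<in> {1..g}" for j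
      using rise[of 1 "j - 1"] that by simp
    thus ?thesis using cover by blast
  qed
  have fall: "u \<in> Z" if "i \<in> {1..s}" "path_edge u k i \<subseteq> Z" for i
    using that
  proof (induction i)
    case (Suc i)
    show ?case
    proof (cases "i = 0")
      case True
      thus ?thesis using Suc.prems by (auto simp: path_edge_def path_vertex_def)
    next
      case False
      have "path_vertex u (Suc i) \<in> path_edge u k i" "path_vertex u (Suc i) \<in> Z"
        using Suc.prems by (auto simp: path_edge_def)
      thus ?thesis using False Suc.prems pth[of i] Suc.IH by auto
    qed
  qed simp
  from Z(1,2) obtain v where v: "v \<in> Z" "v \<in> verts ?G" by blast
  have uZ: "u \<in> Z"
  proof (cases "v \<in> verts (hypercycle g k)")
    case True
    thus ?thesis using all_cyc v(1) u by blast
  next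
    case False
    then obtain i where "i \<in> {1..s}" "v \<in> path_edge u k i" using v(2) by (auto simp: attach_path_def)
    thus ?thesis using pth v(1) fall by blast
  qed
  have "path_edge u k (Suc i) \<subseteq> Z" if "Suc i \<le> s" for i
    using that
  proof (induction i)
    case 0
    have "u \<in> path_edge u k 1" by (simp add: path_edge_def path_vertex_def)
    thus ?case using pth[of 1 u] uZ s by simp
  next
    case (Suc i)
    have "path_vertex u (Suc (Suc i)) \<in> path_edge u k (Suc i)"
      "path_vertex u (Suc (Suc i)) \<in> path_edge u k (Suc (Suc i))"
      by (auto simp: path_edge_def)
    thus ?case using Suc pth[of "Suc (Suc i)"] by auto
  qed
  hence "path_edge u k i \<subseteq> Z" if "i \<in> {1..s}" for i
    using that by (cases i) auto
  hence "(\<Union>i\<in>{1..s}. path_edge u k i) \<subseteq> Z" by blast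
  hence "verts ?G \<subseteq> Z" using all_cyc[OF u uZ] by (simp add: attach_path_def)
  thus "Z = verts ?G" using Z(1) by blast
qed

section \<open>Positive eigenfunctions of a lollipop\<close>

text \<open>
  The two kinds of lollipop are treated together: the path hangs at \<open>v\<^sub>1\<close> or at an inner vertex of the
  first edge, and from \<open>v\<^sub>2\<close> on the hypercycle looks as it would without the path.
\<close>

locale lollipop_eigenfunction =
  fixes k g s :: nat and u :: vertex and x :: "vertex \<Rightarrow> real" and \<mu> :: real
  assumes k: "3 \<le> k" and g: "2 \<le> g" and s: "1 \<le> s"
    and u: "u \<in> insert (Cyc 1) (CycIn 1 ` {1..k - 2})"
    and pos: "\<And>v. v \<in> verts (attach_path (hypercycle g k) u k s) \<Longrightarrow> 0 < x v"
    and eigen: "\<And>v. v \<in> verts (attach_path (hypercycle g k) u k s) \<Longrightarrow>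
      edge_op (attach_path (hypercycle g k) u k s) x v = \<mu> * x v"
begin

abbreviation lollipop :: "nat \<Rightarrow> vertex hypergraph" where
  "lollipop h \<equiv> attach_path (hypercycle h k) u k s"

text \<open>
  The values \<open>cyc\<close> are indexed by \<open>1..g + 1\<close> and the edge sums by \<open>0..g\<close>, the extra index repeating the
  other end, so that both neighbours of a position are reached by \<open>\<plusminus> 1\<close> without reduction modulo \<open>g\<close>.
\<close>

definition cyc :: "nat \<Rightarrow> real" where
  "cyc i = x (Cyc (if i = g + 1 then 1 else i))"

definition edge_sum :: "nat \<Rightarrow> real" where
  "edge_sum i = sum x (cycle_edge g k (if i = 0 then g else i))"

definition pend :: "vertex \<Rightarrow> real" where
  "pend = path_op u k s x"

lemma attachment_in_hypercycle:
  assumes "1 \<le> h" shows "u \<in> verts (hypercycle h k)"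
  using assms u k by (auto simp: hypercycle_def)

lemma Cyc_vert: "1 \<le> i \<Longrightarrow> i \<le> h \<Longrightarrow> Cyc i \<in> verts (lollipop h)"
  by (auto simp: attach_path_def hypercycle_def)

lemma CycIn_vert: "1 \<le> i \<Longrightarrow> i \<le> h \<Longrightarrow> j \<in> {1..k - 2} \<Longrightarrow> CycIn i j \<in> verts (lollipop h)"
  by (auto simp: attach_path_def hypercycle_def)

lemma path_vert: "i \<in> {1..s} \<Longrightarrow> v \<in> path_edge u k i \<Longrightarrow> v \<in> verts (lollipop h)"
  by (auto simp: attach_path_def)

lemma cyc_wrap: "cyc 1 = cyc (g + 1)" and edge_sum_wrap: "edge_sum g = edge_sum 0"
  by (simp_all add: cyc_def edge_sum_def)

lemma cyc_pos: "1 \<le> i \<Longrightarrow> i \<le> g + 1 \<Longrightarrow> 0 < cyc i"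
  using g by (auto simp: cyc_def intro!: pos Cyc_vert)

lemma pend_nonneg: "0 \<le> pend v"
  unfolding pend_def using pos path_vert by (intro path_op_nonneg) (auto intro: less_imp_le)

lemma pend_attachment_pos: "0 < pend u"
  unfolding pend_def using pos path_vert g
  by (intro path_op_attachment_pos[OF k s attachment_in_hypercycle[of g]]) auto

lemma pend_later_eq_0:
  assumes "2 \<le> i"
  shows "pend (Cyc i) = 0" "pend (CycIn i j) = 0"
  unfolding pend_def using assms u
  by (auto intro!: path_op_eq_0 simp: path_edge_def path_vertex_def split: if_splits)

lemma eigen_Cyc:
  assumes "1 \<le> i" "i \<le> g"
  shows "(\<mu> + 2) * cyc i = edge_sum i + edge_sum (i - 1) + pend (Cyc i)"
  using edge_op_Cyc[OF k attachment_in_hypercycle g assms, of s x] eigen[OF Cyc_vert[OF assms]] assms g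
  by (auto simp: cyc_def edge_sum_def pend_def cyclic_pred_def algebra_simps split: if_splits)

lemma eigen_CycIn:
  assumes "1 \<le> i" "i \<le> g" "j \<in> {1..k - 2}"
  shows "(\<mu> + 1) * x (CycIn i j) = edge_sum i + pend (CycIn i j)"
  using edge_op_CycIn[OF k attachment_in_hypercycle _ assms(3), of g i s x]
    eigen[OF CycIn_vert[OF assms]] assms g
  by (simp add: edge_sum_def pend_def algebra_simps)

lemma edge_sum_eq:
  assumes "1 \<le> i" "i \<le> g"
  shows "edge_sum i = cyc i + cyc (i + 1) + (\<Sum>j = 1..k - 2. x (CycIn i j))"
  using sum_cycle_edge[OF g assms, of x k] assms by (auto simp: edge_sum_def cyc_def)

text \<open>
  The inner vertices are eliminated by adding their equations. What remains depends on the two ends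
  of the edge and, if the path hangs at an inner vertex of the edge, on the path.
\<close>

lemma edge_sum_eigen:
  assumes i: "1 \<le> i" "i \<le> g"
  shows "(\<mu> + 3 - k) * edge_sum i
    = (\<mu> + 1) * (cyc i + cyc (i + 1)) + (\<Sum>j = 1..k - 2. pend (CycIn i j))"
proof -
  have "(\<mu> + 1) * edge_sum i
      = (\<mu> + 1) * (cyc i + cyc (i + 1)) + (\<Sum>j = 1..k - 2. (\<mu> + 1) * x (CycIn i j))"
    by (simp add: edge_sum_eq[OF i] distrib_left sum_distrib_left)
  also have "(\<Sum>j = 1..k - 2. (\<mu> + 1) * x (CycIn i j))
      = (\<Sum>j = 1..k - 2. edge_sum i + pend (CycIn i j))"
    using eigen_CycIn i by (intro sum.cong) auto
  also have "\<dots> = (real k - 2) * edge_sum i + (\<Sum>j = 1..k - 2. pend (CycIn i j))"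
    using k by (simp add: sum.distrib of_nat_diff)
  finally show ?thesis by (simp add: algebra_simps)
qed

lemma edge_sum_pos:
  assumes "1 \<le> i" "i \<le> g"
  shows "0 < edge_sum i"
  unfolding edge_sum_eq[OF assms] using cyc_pos assms CycIn_vert[of i g] pos
  by (intro add_pos_nonneg add_pos_pos sum_nonneg) (auto intro: less_imp_le)

lemma edge_sum_ge:
  assumes "1 \<le> i" "i \<le> g"
  shows "(\<mu> + 1) * (cyc i + cyc (i + 1)) \<le> (\<mu> + 3 - k) * edge_sum i"
  unfolding edge_sum_eigen[OF assms] using pend_nonneg by (simp add: sum_nonneg)

text \<open>
  Both signs are read off from equations between positive quantities; they make it possible to
  divide by these factors.
\<close>

lemma eigenvalue_bounds: "0 < \<mu> + 1" "0 < \<mu> + 3 - k"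
proof -
  have "0 < edge_sum 1 + pend (CycIn 1 1)"
    using edge_sum_pos[of 1] pend_nonneg[of "CycIn 1 1"] g by simp
  hence "0 < (\<mu> + 1) * x (CycIn 1 1)" using eigen_CycIn[of 1 1] g k by simp
  moreover have "1 \<in> {1..k - 2}" using k by simp
  hence "0 < x (CycIn 1 1)" using pos[OF CycIn_vert[of 1 g 1]] g by simp
  ultimately show \<mu>1: "0 < \<mu> + 1" by (simp add: zero_less_mult_iff)
  have "0 < cyc 1" "0 < cyc (1 + 1)" using g by (auto intro!: cyc_pos)
  hence "0 < (\<mu> + 1) * (cyc 1 + cyc (1 + 1))" using \<mu>1 by simp
  hence "0 < (\<mu> + 3 - k) * edge_sum 1" using edge_sum_ge[of 1] g by linarith
  thus "0 < \<mu> + 3 - k" using edge_sum_pos[of 1] g by (simp add: zero_less_mult_iff)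
qed

text \<open>
  The eigenvalue exceeds that of the bare hypercycle, for which equality would hold. Adding the
  eigenvalue equations over the whole hypercycle leaves a relation between the sum of the values \<open>cyc\<close>
  and the contribution of the pendant path, which is positive at the attachment vertex.
\<close>

lemma eigenvalue_gt_hypercycle: "4 * (\<mu> + 1) < (\<mu> + 2) * (\<mu> + 3 - k)"
proof -
  define A where "A = (\<Sum>i = 1..g. cyc i)"
  define T where "T = (\<Sum>i = 1..g. edge_sum i)"
  define P where "P = (\<Sum>i = 1..g. pend (Cyc i))"
  define Q where "Q = (\<Sum>i = 1..g. \<Sum>j = 1..k - 2. pend (CycIn i j))"
  have A_shift: "A = (\<Sum>i = 1..g. cyc (i + 1))"
  proof -
    have "(\<Sum>i = 1..g. cyc (i + 1) - cyc i) = cyc (g + 1) - cyc 1"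
      using sum_Suc_diff[of 1 g cyc] by simp
    thus ?thesis using cyc_wrap by (simp add: A_def sum_subtractf)
  qed
  have T_shift: "T = (\<Sum>i = 1..g. edge_sum (i - 1))"
  proof -
    have "(\<Sum>i = 1..g. edge_sum (i - 1)) = (\<Sum>i = 0..<g. edge_sum i)"
      by (rule sum.reindex_bij_witness[of _ Suc "\<lambda>i. i - 1"]) auto
    also have "\<dots> = edge_sum g + (\<Sum>i = 1..<g. edge_sum i)"
      using g by (simp add: sum.atLeast_Suc_lessThan edge_sum_wrap)
    also have "\<dots> = T"
      using g unfolding T_def by (cases g) (auto simp: atLeastLessThanSuc_atLeastAtMost)
    finally show ?thesis by simp
  qed
  have "(\<mu> + 2) * A = (\<Sum>i = 1..g. edge_sum i + edge_sum (i - 1) + pend (Cyc i))"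
    unfolding A_def sum_distrib_left using eigen_Cyc by (intro sum.cong) auto
  hence vertices: "(\<mu> + 2) * A = 2 * T + P"
    unfolding sum.distrib P_def using T_shift T_def by simp
  have "(\<mu> + 3 - k) * T
      = (\<Sum>i = 1..g. (\<mu> + 1) * (cyc i + cyc (i + 1)) + (\<Sum>j = 1..k - 2. pend (CycIn i j)))"
    unfolding T_def sum_distrib_left using edge_sum_eigen by (intro sum.cong) auto
  hence edges: "(\<mu> + 3 - k) * T = 2 * (\<mu> + 1) * A + Q"
    unfolding sum.distrib Q_def sum_distrib_left[symmetric] A_shift[symmetric] A_def[symmetric]
    by simp
  have PQ: "0 \<le> P" "0 \<le> Q" unfolding P_def Q_def using pend_nonneg by (auto intro!: sum_nonneg)
  have "0 < P \<or> 0 < Q"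
  proof (cases "u = Cyc 1")
    case True
    hence "0 < P" unfolding P_def using pend_attachment_pos pend_nonneg g
      by (intro sum_pos2[of _ 1]) auto
    thus ?thesis ..
  next
    case False
    with u obtain j where j: "j \<in> {1..k - 2}" "u = CycIn 1 j" by auto
    have "0 < (\<Sum>j = 1..k - 2. pend (CycIn 1 j))"
      using pend_attachment_pos pend_nonneg j by (intro sum_pos2[of _ j]) auto
    hence "0 < Q" unfolding Q_def using pend_nonneg g
      by (intro sum_pos2[of "{1..g}" 1]) (auto intro: sum_nonneg)
    thus ?thesis ..
  qed
  hence "0 < 2 * Q + (\<mu> + 3 - k) * P"
    using PQ eigenvalue_bounds(2) by (auto intro: add_nonneg_pos add_pos_nonneg)
  moreover have "(\<mu> + 2) * (\<mu> + 3 - k) * A = 4 * (\<mu> + 1) * A + (2 * Q + (\<mu> + 3 - k) * P)"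
  proof -
    have "(\<mu> + 2) * (\<mu> + 3 - k) * A = (\<mu> + 3 - k) * ((\<mu> + 2) * A)" by simp
    also have "\<dots> = 2 * ((\<mu> + 3 - k) * T) + (\<mu> + 3 - k) * P"
      unfolding vertices by (simp add: distrib_left)
    finally show ?thesis unfolding edges by (simp add: distrib_left)
  qed
  ultimately have "4 * (\<mu> + 1) * A < (\<mu> + 2) * (\<mu> + 3 - k) * A" by linarith
  moreover have "0 < A" unfolding A_def using cyc_pos g by (intro sum_pos) auto
  ultimately show ?thesis by (simp only: mult_less_cancel_right_pos)
qed

text \<open>
  The vertex to be split. The range starts at \<open>2\<close>, with \<open>g + 1\<close> standing for \<open>v\<^sub>1\<close>, so that the new
  edge never takes the place of the first one, which may carry the pendant path.
\<close>

lemma ex_minimal_cyc: "\<exists>m\<in>{2..g + 1}. \<forall>i\<in>{1..g + 1}. cyc m \<le> cyc i"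
proof -
  have "Min (cyc ` {2..g + 1}) \<in> cyc ` {2..g + 1}" using g by (intro Min_in) auto
  then obtain m where m: "m \<in> {2..g + 1}" "cyc m = Min (cyc ` {2..g + 1})" by auto
  have "cyc m \<le> cyc i" if "i \<in> {1..g + 1}" for i
  proof (cases "i = 1")
    case True
    thus ?thesis using m g cyc_wrap by simp
  next
    case False
    thus ?thesis using m that by simp
  qed
  thus ?thesis using m(1) by blast
qed

end

section \<open>Splitting a vertex of minimal value\<close>

locale lollipop_split = lollipop_eigenfunction +
  fixes m :: nat
  assumes m: "m \<in> {2..g + 1}" and cyc_min: "\<And>i. 1 \<le> i \<Longrightarrow> i \<le> g + 1 \<Longrightarrow> cyc m \<le> cyc i"
begin

text \<open>
  This value solves the eigenvalue equation at the inner vertices of an edge whose two ends both have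
  value \<open>cyc m\<close>; accordingly \<open>new_sum\<close> is the sum over such an edge.
\<close>

definition new_value :: real where
  "new_value = 2 * cyc m / (\<mu> + 3 - k)"

definition new_sum :: real where
  "new_sum = (\<mu> + 1) * new_value"

text \<open>
  The two copies of the split vertex are \<open>v\<^sub>m\<close> and \<open>v\<^bsub>m + 1\<^esub>\<close> and the new edge is the \<open>m\<close>-th; what came
  after \<open>v\<^sub>m\<close> has moved up by one index. For \<open>m = g + 1\<close> the copies are \<open>v\<^bsub>g + 1\<^esub>\<close> and \<open>v\<^sub>1\<close>.
\<close>

definition split_fun :: "vertex \<Rightarrow> real" where
  "split_fun v = (case v of
      Cyc i \<Rightarrow> cyc (if i \<le> m then i else i - 1)
    | CycIn i j \<Rightarrow>
        (if i < m then x (CycIn i j) else if i = m then new_value else x (CycIn (i - 1) j))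
    | _ \<Rightarrow> x v)"

definition split_edge_sum :: "nat \<Rightarrow> real" where
  "split_edge_sum i = sum split_fun (cycle_edge (g + 1) k i)"

lemma new_value_eq: "(\<mu> + 3 - k) * new_value = 2 * cyc m"
  using eigenvalue_bounds(2) by (simp add: new_value_def)

lemma new_value_pos: "0 < new_value"
  using cyc_pos[of m] m eigenvalue_bounds(2) by (simp add: new_value_def)

lemma new_sum_eq: "new_sum = 2 * cyc m + (real k - 2) * new_value"
  unfolding new_value_eq[symmetric] new_sum_def by (simp add: algebra_simps)

text \<open>
  Up to a nonnegative contribution of the path, every edge sum is the same positive multiple of the
  sum of the two end values; the new edge has the minimal value at both ends.
\<close>

lemma new_sum_le:
  assumes i: "1 \<le> i" "i \<le> g"
  shows "new_sum \<le> edge_sum i"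
proof -
  have "(\<mu> + 3 - k) * new_sum = (\<mu> + 1) * (cyc m + cyc m)"
    using new_value_eq unfolding new_sum_def by (simp add: ac_simps)
  also have "\<dots> \<le> (\<mu> + 1) * (cyc i + cyc (i + 1))"
    using eigenvalue_bounds(1) cyc_min i by (intro mult_left_mono add_mono) auto
  also have "\<dots> \<le> (\<mu> + 3 - k) * edge_sum i" by (rule edge_sum_ge[OF i])
  finally show ?thesis using eigenvalue_bounds(2) by simp
qed

lemma new_sum_less: "2 * new_sum < (\<mu> + 2) * cyc m"
proof -
  have "(\<mu> + 3 - k) * (2 * new_sum) = 4 * (\<mu> + 1) * cyc m"
    using new_value_eq unfolding new_sum_def by (simp add: ac_simps)
  also have "\<dots> < (\<mu> + 2) * (\<mu> + 3 - k) * cyc m"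
    using eigenvalue_gt_hypercycle cyc_pos[of m] m by simp
  also have "\<dots> = (\<mu> + 3 - k) * ((\<mu> + 2) * cyc m)" by simp
  finally show ?thesis using eigenvalue_bounds(2) by (simp only: mult_less_cancel_left_pos)
qed

lemma path_op_split_fun: "path_op u k s split_fun v = pend v"
proof -
  have "split_fun u = x u" using u m by (auto simp: split_fun_def cyc_def)
  thus ?thesis
    unfolding pend_def
    by (intro path_op_cong) (auto simp: split_fun_def path_edge_def path_vertex_def split: if_splits)
qed

lemma split_edge_sum_eq:
  assumes i: "1 \<le> i" "i \<le> g + 1"
  shows "split_edge_sum i
    = (if i < m then edge_sum i else if i = m then new_sum else edge_sum (i - 1))"
proof -
  have "split_edge_sum i = split_fun (Cyc i) + split_fun (Cyc (if i = g + 1 then 1 else i + 1))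
      + (\<Sum>j = 1..k - 2. split_fun (CycIn i j))"
    unfolding split_edge_sum_def using g i by (intro sum_cycle_edge) auto
  also have "split_fun (Cyc (if i = g + 1 then 1 else i + 1)) = cyc (if i < m then i + 1 else i)"
    using m i by (auto simp: split_fun_def cyc_def)
  finally have eq: "split_edge_sum i = split_fun (Cyc i) + cyc (if i < m then i + 1 else i)
      + (\<Sum>j = 1..k - 2. split_fun (CycIn i j))" .
  consider "i < m" | "i = m" | "m < i" by linarith
  thus ?thesis
  proof cases
    case 1
    thus ?thesis using eq edge_sum_eq[of i] i m by (simp add: split_fun_def)
  next
    case 2
    thus ?thesis using eq new_sum_eq k by (simp add: split_fun_def of_nat_diff)
  next
    case 3
    thus ?thesis using eq edge_sum_eq[of "i - 1"] i m by (simp add: split_fun_def)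
  qed
qed

lemma edge_op_split_Cyc:
  assumes "1 \<le> i" "i \<le> g + 1"
  shows "edge_op (lollipop (g + 1)) split_fun (Cyc i) =
    split_edge_sum i + split_edge_sum (cyclic_pred (g + 1) i) - 2 * split_fun (Cyc i) + pend (Cyc i)"
  unfolding split_edge_sum_def
  using edge_op_Cyc[OF k attachment_in_hypercycle _ assms, of s split_fun] g
  by (simp add: path_op_split_fun)

text \<open>
  Away from the two copies of the split vertex these are the old eigenvalue equations. At each
  copy one of the two old edge sums has been replaced by \<open>new_sum\<close>, which is no larger. If \<open>v\<^sub>1\<close> is
  split, the path stays at one copy, and the other loses its nonnegative contribution.
\<close>

lemma split_supersolution_Cyc:
  assumes i: "1 \<le> i" "i \<le> g + 1"
  shows "edge_op (lollipop (g + 1)) split_fun (Cyc i) \<le> \<mu> * split_fun (Cyc i)"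
proof -
  have "split_edge_sum i + split_edge_sum (cyclic_pred (g + 1) i) + pend (Cyc i)
      \<le> (\<mu> + 2) * split_fun (Cyc i)"
  proof -
    consider "i = 1" | "1 < i" "i < m" | "i = m" "m \<le> g" | "i = m" "m = g + 1"
      | "i = m + 1" | "m + 1 < i" using i m by force
    thus ?thesis
    proof cases
      case 1
      have "split_edge_sum (g + 1) \<le> edge_sum 0"
        using split_edge_sum_eq[of "g + 1"] m new_sum_le[of g] g edge_sum_wrap by auto
      moreover have "split_edge_sum 1 = edge_sum 1" using split_edge_sum_eq[of 1] m by simp
      moreover have "split_fun (Cyc 1) = cyc 1" using m by (simp add: split_fun_def)
      ultimately show ?thesis using 1 eigen_Cyc[of 1] g by (simp add: cyclic_pred_def)
    next
      case 2
      hence "split_edge_sum (i - 1) = edge_sum (i - 1)" "split_edge_sum i = edge_sum i"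
        using split_edge_sum_eq[of "i - 1"] split_edge_sum_eq[of i] m by auto
      moreover have "split_fun (Cyc i) = cyc i" using 2 by (simp add: split_fun_def)
      ultimately show ?thesis using 2 eigen_Cyc[of i] m by (simp add: cyclic_pred_def)
    next
      case 3
      have "split_edge_sum (i - 1) = edge_sum (i - 1)" "split_edge_sum i = new_sum"
        using split_edge_sum_eq[of "i - 1"] split_edge_sum_eq[of i] 3 m by auto
      moreover have "split_fun (Cyc i) = cyc i" using 3 by (simp add: split_fun_def)
      ultimately show ?thesis
        using 3 eigen_Cyc[of i] new_sum_le[of i] m by (simp add: cyclic_pred_def)
    next
      case 4
      have "g < m" "2 \<le> i" using 4 m by auto
      hence "split_edge_sum g = edge_sum 0" "split_edge_sum i = new_sum"
        using split_edge_sum_eq[of g] split_edge_sum_eq[of i] 4(1) i g edge_sum_wrap by auto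
      moreover have "split_fun (Cyc i) = cyc m" using 4(1) by (simp add: split_fun_def)
      moreover have "cyc m = cyc 1" using 4(2) cyc_wrap by simp
      moreover have "cyclic_pred (g + 1) i = g" using 4 g by (simp add: cyclic_pred_def)
      moreover have "new_sum \<le> edge_sum 1" using new_sum_le g by simp
      ultimately show ?thesis
        using eigen_Cyc[of 1] g pend_nonneg[of "Cyc 1"] pend_later_eq_0(1)[OF \<open>2 \<le> i\<close>] by simp
    next
      case 5
      have "split_edge_sum i = edge_sum m" "split_edge_sum m = new_sum"
        using split_edge_sum_eq[of i] split_edge_sum_eq[of m] 5 m i by auto
      moreover have "split_fun (Cyc i) = cyc m" using 5 by (simp add: split_fun_def)
      moreover have "cyclic_pred (g + 1) i = m" using 5 m by (simp add: cyclic_pred_def)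
      moreover have "new_sum \<le> edge_sum (m - 1)" using new_sum_le[of "m - 1"] m by auto
      moreover have "pend (Cyc i) = 0" "pend (Cyc m) = 0"
        using pend_later_eq_0(1)[of i] pend_later_eq_0(1)[of m] 5 m by auto
      ultimately show ?thesis using eigen_Cyc[of m] 5 m i by simp
    next
      case 6
      have "split_edge_sum i = edge_sum (i - 1)" "split_edge_sum (i - 1) = edge_sum (i - 1 - 1)"
        using split_edge_sum_eq[of i] split_edge_sum_eq[of "i - 1"] 6 m i by auto
      moreover have "split_fun (Cyc i) = cyc (i - 1)" using 6 by (simp add: split_fun_def)
      moreover have "cyclic_pred (g + 1) i = i - 1" using 6 by (simp add: cyclic_pred_def)
      moreover have "pend (Cyc i) = 0" "pend (Cyc (i - 1)) = 0"
        using pend_later_eq_0(1)[of i] pend_later_eq_0(1)[of "i - 1"] 6 m by auto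
      moreover have "1 \<le> i - 1" "i - 1 \<le> g" using 6 i by auto
      ultimately show ?thesis using eigen_Cyc[of "i - 1"] by simp
    qed
  qed
  thus ?thesis unfolding edge_op_split_Cyc[OF i] by (simp add: algebra_simps)
qed

lemma split_supersolution_CycIn:
  assumes ij: "1 \<le> i" "i \<le> g + 1" "j \<in> {1..k - 2}"
  shows "0 < split_fun (CycIn i j)"
    and "edge_op (lollipop (g + 1)) split_fun (CycIn i j) \<le> \<mu> * split_fun (CycIn i j)"
proof -
  have op: "edge_op (lollipop (g + 1)) split_fun (CycIn i j)
      = split_edge_sum i - split_fun (CycIn i j) + pend (CycIn i j)"
    using edge_op_CycIn[OF k attachment_in_hypercycle _ ij(3), of "g + 1" i s split_fun] ij
    by (simp add: split_edge_sum_def path_op_split_fun)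
  consider "i < m" | "i = m" | "m < i" by linarith
  hence "0 < split_fun (CycIn i j) \<and>
    edge_op (lollipop (g + 1)) split_fun (CycIn i j) \<le> \<mu> * split_fun (CycIn i j)"
  proof cases
    case 1
    thus ?thesis using op ij split_edge_sum_eq[of i] eigen_CycIn[of i j] pos[OF CycIn_vert[of i g j]] m
      by (simp add: split_fun_def algebra_simps)
  next
    case 2
    thus ?thesis using new_value_pos op ij split_edge_sum_eq[of i] m pend_later_eq_0(2)[of i j]
      by (simp add: split_fun_def new_sum_def algebra_simps)
  next
    case 3
    hence "1 \<le> i - 1" "i - 1 \<le> g" "2 \<le> i - 1" "2 \<le> i" using ij m by auto
    hence "(\<mu> + 1) * x (CycIn (i - 1) j) = edge_sum (i - 1)" "0 < x (CycIn (i - 1) j)"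
      "pend (CycIn i j) = 0"
      using eigen_CycIn[of "i - 1" j] pos[OF CycIn_vert[of "i - 1" g j]] ij(3)
        pend_later_eq_0(2)[of i j] pend_later_eq_0(2)[of "i - 1" j] by auto
    moreover have "split_fun (CycIn i j) = x (CycIn (i - 1) j)" using 3 by (simp add: split_fun_def)
    moreover have "split_edge_sum i = edge_sum (i - 1)" using split_edge_sum_eq[of i] 3 ij by simp
    ultimately show ?thesis using op by (simp add: algebra_simps)
  qed
  thus "0 < split_fun (CycIn i j)"
    "edge_op (lollipop (g + 1)) split_fun (CycIn i j) \<le> \<mu> * split_fun (CycIn i j)" by blast+
qed

lemma split_supersolution:
  assumes v: "v \<in> verts (lollipop (g + 1))"
  shows "0 < split_fun v" and "edge_op (lollipop (g + 1)) split_fun v \<le> \<mu> * split_fun v"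
proof -
  from v have "(\<exists>i. 1 \<le> i \<and> i \<le> g + 1 \<and> v = Cyc i)
    \<or> (\<exists>i j. 1 \<le> i \<and> i \<le> g + 1 \<and> j \<in> {1..k - 2} \<and> v = CycIn i j)
    \<or> ((\<forall>i. v \<noteq> Cyc i) \<and> (\<forall>i j. v \<noteq> CycIn i j) \<and> (\<exists>i\<in>{1..s}. v \<in> path_edge u k i))"
    using u k g
    by (cases v)
      (auto simp: attach_path_def hypercycle_def path_edge_def path_vertex_def split: if_splits)
  then consider (cycle_vertex) i where "1 \<le> i" "i \<le> g + 1" "v = Cyc i"
    | (inner) i j where "1 \<le> i" "i \<le> g + 1" "j \<in> {1..k - 2}" "v = CycIn i j"
    | (path) i where "\<And>i. v \<noteq> Cyc i" "\<And>i j. v \<noteq> CycIn i j" "i \<in> {1..s}" "v \<in> path_edge u k i"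
    by blast
  hence "0 < split_fun v \<and> edge_op (lollipop (g + 1)) split_fun v \<le> \<mu> * split_fun v"
  proof cases
    case cycle_vertex
    thus ?thesis using split_supersolution_Cyc cyc_pos m by (auto simp: split_fun_def)
  next
    case inner
    thus ?thesis using split_supersolution_CycIn by blast
  next
    case path
    have "v \<in> verts (lollipop g)" by (rule path_vert[OF path(3,4)])
    moreover have "split_fun v = x v" using path(1,2) by (cases v) (auto simp: split_fun_def)
    ultimately show ?thesis
      using edge_op_path[OF k attachment_in_hypercycle path(1,2), of "g + 1" s split_fun]
        edge_op_path[OF k attachment_in_hypercycle path(1,2), of g s x] pos eigen g
      by (simp add: path_op_split_fun pend_def)
  qed
  thus "0 < split_fun v" "edge_op (lollipop (g + 1)) split_fun v \<le> \<mu> * split_fun v" by blast+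
qed

text \<open>
  The slacks at the two copies of the split vertex add up to \<open>(\<mu> + 2) * cyc m - 2 * new_sum\<close>. It is
  positive because \<open>\<mu>\<close> exceeds the eigenvalue of the bare hypercycle.
\<close>

lemma split_supersolution_strict:
  "\<exists>v\<in>verts (lollipop (g + 1)). edge_op (lollipop (g + 1)) split_fun v < \<mu> * split_fun v"
proof -
  let ?op = "edge_op (lollipop (g + 1)) split_fun"
  \<comment> \<open>the copy that follows \<open>v\<^sub>m\<close>; for \<open>m = g + 1\<close> it is \<open>v\<^sub>1\<close>, so a path attached there stays\<close>
  define q where "q = (if m = g + 1 then 1 else m + 1)"
  have q: "1 \<le> q" "q \<le> g + 1" "cyclic_pred (g + 1) q = m"
    using m by (auto simp: q_def cyclic_pred_def)
  have mV: "1 \<le> m" "m \<le> g + 1" using m by auto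
  have copies: "split_fun (Cyc m) = cyc m" "split_fun (Cyc q) = cyc m"
    using m cyc_wrap by (auto simp: split_fun_def q_def)
  have outer: "split_edge_sum (cyclic_pred (g + 1) m) + split_edge_sum q + pend (Cyc m) + pend (Cyc q)
      = (\<mu> + 2) * cyc m"
  proof (cases "m = g + 1")
    case True
    have "g < m" using True by simp
    hence "split_edge_sum g = edge_sum 0" "split_edge_sum 1 = edge_sum 1"
      using split_edge_sum_eq[of g] split_edge_sum_eq[of 1] g edge_sum_wrap by auto
    moreover have "cyclic_pred (g + 1) m = g" "q = 1"
      using True g by (auto simp: cyclic_pred_def q_def)
    moreover have "cyc m = cyc 1" using True cyc_wrap by simp
    moreover have "pend (Cyc m) = 0" using pend_later_eq_0(1)[of m] m by simp
    ultimately show ?thesis using eigen_Cyc[of 1] g by simp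
  next
    case False
    have "split_edge_sum (m - 1) = edge_sum (m - 1)" "split_edge_sum (m + 1) = edge_sum m"
      using split_edge_sum_eq[of "m - 1"] split_edge_sum_eq[of "m + 1"] m False by auto
    moreover have "cyclic_pred (g + 1) m = m - 1" "q = m + 1"
      using False m by (auto simp: cyclic_pred_def q_def)
    moreover have "pend (Cyc m) = 0" "pend (Cyc (m + 1)) = 0"
      using pend_later_eq_0(1)[of m] pend_later_eq_0(1)[of "m + 1"] m by auto
    ultimately show ?thesis using eigen_Cyc[of m] m False by simp
  qed
  have "split_edge_sum m = new_sum" using split_edge_sum_eq[OF mV] by simp
  hence "?op (Cyc m) + ?op (Cyc q) < \<mu> * split_fun (Cyc m) + \<mu> * split_fun (Cyc q)"
    unfolding edge_op_split_Cyc[OF mV] edge_op_split_Cyc[OF q(1,2)] q(3) copies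
    using outer new_sum_less by (simp add: algebra_simps)
  hence "?op (Cyc m) < \<mu> * split_fun (Cyc m) \<or> ?op (Cyc q) < \<mu> * split_fun (Cyc q)" by linarith
  thus ?thesis using Cyc_vert[OF mV] Cyc_vert[OF q(1,2)] by blast
qed

end

section \<open>Spectral radii of lollipops\<close>

theorem spectral_radius_lollipop_decreasing:
  assumes k: "3 \<le> k" and g: "2 \<le> g" and s: "1 \<le> s"
    and u: "u \<in> insert (Cyc 1) (CycIn 1 ` {1..k - 2})"
  shows "hg_spectral_radius (attach_path (hypercycle (g + 1) k) u k s)
    < hg_spectral_radius (attach_path (hypercycle g k) u k s)"
proof -
  let ?G = "attach_path (hypercycle g k) u k s"
  let ?G' = "attach_path (hypercycle (g + 1) k) u k s"
  have uV: "u \<in> verts (hypercycle g k)" "u \<in> verts (hypercycle (g + 1) k)"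
    using u k g by (auto simp: hypercycle_def)
  have g': "2 \<le> g + 1" and k2: "2 \<le> k" using g k by auto
  define \<mu> where "\<mu> = (real k - 1) * hg_spectral_radius ?G"
  from hypergraph_perron_positive[OF attach_path_wellformed[OF k g uV(1)] k2
      lollipop_connected[OF k g s uV(1)]]
  obtain x where pos: "\<And>v. v \<in> verts ?G \<Longrightarrow> 0 < x v"
    and eigen: "\<And>v. v \<in> verts ?G \<Longrightarrow> edge_op ?G x v = \<mu> * x v"
    by (auto simp: \<mu>_def)
  interpret lollipop_eigenfunction k g s u x \<mu>
    using k g s u pos eigen by unfold_locales
  obtain m where "m \<in> {2..g + 1}" "\<And>i. 1 \<le> i \<Longrightarrow> i \<le> g + 1 \<Longrightarrow> cyc m \<le> cyc i"
    using ex_minimal_cyc by auto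
  then interpret lollipop_split k g s u x \<mu> m
    by unfold_locales
  have "(real k - 1) * hg_spectral_radius ?G' < \<mu>"
    by (rule spectral_radius_less_of_supersolution[OF attach_path_wellformed[OF k g' uV(2)] k2
          lollipop_connected[OF k g' s uV(2)] split_supersolution split_supersolution_strict])
  thus ?thesis using k by (simp add: \<mu>_def)
qed

theorem theorem1p5:
  fixes k g s :: nat
  assumes "3 \<le> k" and "2 \<le> g" and "1 \<le> s"
  shows "hg_spectral_radius (Lop1 (g + 1) k s) < hg_spectral_radius (Lop1 g k s) \<and>
         hg_spectral_radius (Lop2 (g + 1) k s) < hg_spectral_radius (Lop2 g k s)"
  unfolding Lop1_def Lop2_def
  using assms by (intro conjI spectral_radius_lollipop_decreasing) auto

end
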